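(* For every finite simple graph $G$, there is a finite set of points $X\subset \mathbb{R}^2$ such that the subgraph of $\mathcal{V}(X\cup \mathbb{Z}^2)$ induced by $X$ is isomorphic to $G$.
   Context: For a discrete point set $S\subset\mathbb{R}^2$, the visibility graph $\mathcal{V}(S)$ is the graph with vertex set $S$ in which two distinct points $x,y\in S$ are adjacent if and only if no other point of $S$ lies on the closed line segment between $x$ and $y$. $\mathbb{Z}^2$ denotes the integer lattice in the plane. *)

theory Defs
  imports "HOL-Analysis.Analysis" "Graph_Theory.Digraph_Isomorphism"
begin

text \<open>
  An undirected simple graph is rendered as in the Graph_Theory library (locale \<open>graph\<close>): a finite
  loop-free digraph without parallel arcs in which each edge is present in both directions.
  The null graph is allowed. The visibility graph of an infinite set has infinitely many vertices,
  so it is not a member of \<open>graph\<close>; its arcs are the ordered pairs of adjacent points.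
\<close>

definition visibility_graph :: "(real^2) set \<Rightarrow> (real^2, (real^2) \<times> (real^2)) pre_digraph" where
  "visibility_graph S =
     \<lparr> verts = S,
       arcs = {(x, y). x \<in> S \<and> y \<in> S \<and> x \<noteq> y \<and>
                 (\<forall>z\<in>S. z \<in> closed_segment x y \<longrightarrow> z = x \<or> z = y)},
       tail = fst, head = snd \<rparr>"

definition integer_lattice :: "(real^2) set" where
  "integer_lattice = {p. \<forall>i. p $ i \<in> \<int>}"

lemma loopfree_digraph_visibility_graph: "loopfree_digraph (visibility_graph S)"
  by unfold_locales (auto simp: visibility_graph_def)

lemma nomulti_digraph_visibility_graph: "nomulti_digraph (visibility_graph S)"
  by unfold_locales (auto simp: visibility_graph_def arc_to_ends_def)

lemma sym_digraph_visibility_graph: "sym_digraph (visibility_graph S)"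
  by unfold_locales
    (auto simp: visibility_graph_def symmetric_conv closed_segment_commute)

end

theory Submission
  imports Defs "HOL-Number_Theory.Cong" "HOL-Computational_Algebra.Primes"
begin

text \<open>
  Give the vertices distinct indices \<open>i v\<close> and the edges distinct primes exceeding all indices. Let
  \<open>N\<close> be the product of these primes, \<open>c v\<close> the product of the primes of the edges that avoid \<open>v\<close>,
  and represent \<open>v\<close> by the point \<open>(N + 1) / N * c v * (1, i v)\<close>.

  For an edge \<open>{u, v}\<close> with prime \<open>q\<close>, scaling by \<open>N\<close> turns every lattice point, and every point
  representing another vertex, into an integer vector divisible by \<open>q\<close>. If such a vector were on the
  line through the points of \<open>u\<close> and \<open>v\<close>, then \<open>q\<close> would divide the determinant
  \<open>(N + 1)\<^sup>2 * c u * c v * (i v - i u)\<close>, which it does not.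

  If \<open>u\<close> and \<open>v\<close> are not adjacent, then no edge contains both, so \<open>N = A * B\<close> with \<open>A\<close> and \<open>B\<close>
  coprime, \<open>A\<close> dividing \<open>c u\<close> and \<open>B\<close> dividing \<open>c v\<close>. The Chinese remainder theorem then provides
  a lattice point that divides the segment in the ratio \<open>k : (N + 1 - k)\<close>.
\<close>

text \<open>The denominator \<open>N\<close> is what makes lattice points divisible by the edge
  primes after scaling. The factor \<open>N + 1\<close>, coprime to \<open>N\<close>, cancels the
  denominator of the ratios \<open>k / (N + 1)\<close>.\<close>

definition fan_point :: "nat \<Rightarrow> nat \<Rightarrow> nat \<Rightarrow> real^2" where
  "fan_point N a i = vector [real ((N + 1) * a) / real N, real ((N + 1) * a * i) / real N]"

text \<open>Modulo \<open>B\<close> the last condition reads k = 1, so \<open>k\<close> solves a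
  pair of congruences with coprime moduli.\<close>

lemma coprime_factors_split_Suc:
  fixes A B :: nat
  assumes "coprime A B" "A * B > 0"
  obtains k where "1 \<le> k" "k \<le> A * B" "A dvd k" "B dvd A * B + 1 - k"
proof -
  have "A \<noteq> 0" "B \<noteq> 0"
    using assms(2) by auto
  \<comment> \<open>Here \<open>x\<close> is k - 1 and \<open>A - 1\<close> stands for -1, so that
    the range 0 \<le> x < A * B shifts to 1 \<le> k \<le> A * B.\<close>
  then obtain x where x: "x < A * B" "[x = A - 1] (mod A)" "[x = 0] (mod B)"
    using binary_chinese_remainder_unique_nat[OF assms(1), of "A - 1" 0] by blast
  show ?thesis
  proof
    have "[x + 1 = A - 1 + 1] (mod A)"
      using x(2) by (rule cong_add) simp
    then show "A dvd Suc x"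
      using \<open>A \<noteq> 0\<close> by (simp add: cong_def dvd_eq_mod_eq_0)
    show "B dvd A * B + 1 - Suc x"
      using x(3) by (simp add: cong_0_iff dvd_diff_nat)
  qed (use x in auto)
qed

text \<open>At \<open>t = k / (N + 1)\<close> each coordinate is
  \<open>((N + 1 - k) * x + k * y) / N\<close>. Since \<open>A\<close> divides \<open>x\<close> and
  \<open>k\<close>, and \<open>B\<close> divides \<open>y\<close> and \<open>N + 1 - k\<close>, the
  numerator is a multiple of \<open>A * B = N\<close>.\<close>

lemma lattice_point_between_fan_points:
  assumes "coprime A B" "A * B = N" "N > 0" "A dvd a" "B dvd b"
    and neq: "fan_point N a i \<noteq> fan_point N b j"
  shows "\<exists>z\<in>integer_lattice. z \<in> open_segment (fan_point N a i) (fan_point N b j)"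
proof -
  obtain k where k: "1 \<le> k" "k \<le> N" "A dvd k" "B dvd N + 1 - k"
    using coprime_factors_split_Suc[of A B] assms by metis
  define t where "t = real k / real (N + 1)"
  have t: "0 < t" "t < 1"
    using k by (auto simp: t_def)
  have int: "(1 - t) * (real ((N + 1) * x) / real N) + t * (real ((N + 1) * y) / real N) \<in> \<int>"
    if "A dvd x" "B dvd y" for x y
  proof -
    have "A dvd (N + 1 - k) * x + k * y" "B dvd (N + 1 - k) * x + k * y"
      using that k by auto
    then have "N dvd (N + 1 - k) * x + k * y"
      using assms(1,2) divides_mult by blast
    then obtain m where "(N + 1 - k) * x + k * y = N * m" ..
    then have "real (N + 1 - k) * real x + real k * real y = real N * real m"
      by (metis of_nat_add of_nat_mult)
    moreover have "real (N + 1 - k) = real N + 1 - real k"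
      using k(2) by simp
    ultimately have m: "(real N + 1 - real k) * real x + real k * real y = real N * real m"
      by metis
    have "(1 - t) * (real ((N + 1) * x) / real N) + t * (real ((N + 1) * y) / real N) =
        ((1 - t) * (real N + 1) * real x + t * (real N + 1) * real y) / real N"
      using \<open>N > 0\<close> by (simp add: field_simps)
    also have "t * (real N + 1) = real k"
      by (simp add: t_def add.commute)
    also have "(1 - t) * (real N + 1) = real N + 1 - real k"
      by (simp add: t_def field_simps)
    also have "((real N + 1 - real k) * real x + real k * real y) / real N = real m"
      using m \<open>N > 0\<close> by simp
    finally show ?thesis
      by simp
  qed
  let ?z = "(1 - t) *\<^sub>R fan_point N a i + t *\<^sub>R fan_point N b j"
  have "?z \<in> integer_lattice"
    using int[of a b] int[of "a * i" "b * j"] assms(4,5)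
    by (simp add: integer_lattice_def fan_point_def forall_2 distrib_right mult.assoc
        del: of_nat_mult of_nat_add)
  moreover have "?z \<in> open_segment (fan_point N a i) (fan_point N b j)"
    using t neq by (auto simp: in_segment)
  ultimately show ?thesis ..
qed

lemma not_between_fan_points:
  fixes z1 z2 :: int
  assumes r: "prime r" "r dvd N" and "N > 0"
    and ab: "\<not> r dvd a" "\<not> r dvd b" and ij: "\<not> int r dvd int j - int i"
    and z: "real N * z $ 1 = of_int z1" "real N * z $ 2 = of_int z2"
    and rz: "int r dvd z1" "int r dvd z2"
  shows "z \<notin> closed_segment (fan_point N a i) (fan_point N b j)"
proof
  assume "z \<in> closed_segment (fan_point N a i) (fan_point N b j)"
  then obtain t where zt: "z = (1 - t) *\<^sub>R fan_point N a i + t *\<^sub>R fan_point N b j"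
    by (auto simp: in_segment)
  define M x y where "M = int N + 1" and "x = M * int a" and "y = M * int b"
  have z1: "of_int z1 = (1 - t) * of_int x + t * of_int y"
    using \<open>N > 0\<close>
    by (simp add: z[symmetric] zt fan_point_def x_def y_def M_def field_simps)
  have z2: "of_int z2 = (1 - t) * of_int (x * int i) + t * of_int (y * int j)"
    using \<open>N > 0\<close>
    by (simp add: z[symmetric] zt fan_point_def x_def y_def M_def field_simps)
  \<comment> \<open>This is det(z, Q - P) = det(P, Q) for the scaled points P = (x, x * i) and Q =
    (y, y * j), valid for every z on their line; \<open>t\<close> cancels.\<close>
  have "real_of_int (z1 * (y * int j - x * int i) - z2 * (y - x)) = of_int (x * y * (int j - int i))"
    unfolding of_int_mult of_int_diff z1 z2 by (simp add: algebra_simps)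
  then have "z1 * (y * int j - x * int i) - z2 * (y - x) = x * y * (int j - int i)"
    using of_int_eq_iff by blast
  then have "int r dvd x * y * (int j - int i)"
    using rz by (metis dvd_diff dvd_mult2)
  moreover have "prime (int r)"
    using r by simp
  moreover have "\<not> int r dvd M"
  proof
    assume "int r dvd M"
    moreover have "int r dvd int N"
      using r by simp
    ultimately have "int r dvd 1"
      unfolding M_def by (simp add: dvd_add_right_iff)
    then show False
      using r by auto
  qed
  ultimately show False
    using ab ij by (auto simp: x_def y_def prime_dvd_mult_iff)
qed

lemma infinite_primes_greater: "infinite {p::nat. prime p \<and> n < p}"
proof
  assume "finite {p::nat. prime p \<and> n < p}"
  then have "finite ({p. prime p \<and> n < p} \<union> {..n})"
    by simp
  then have "finite {p::nat. prime p}"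
    by (rule rev_finite_subset) auto
  then show False
    using primes_infinite by simp
qed

lemma distinct_primes_greater:
  assumes "finite E"
  obtains q :: "'e \<Rightarrow> nat" where "inj_on q E" "\<And>e. prime (q e)" "\<And>e. n < q e"
proof -
  obtain f :: "'e \<Rightarrow> nat" where f: "inj_on f E"
    using finite_imp_inj_to_nat_seg[OF assms] by blast
  obtain g :: "nat \<Rightarrow> nat" where g: "inj g" "range g \<subseteq> {p. prime p \<and> n < p}"
    using infinite_countable_subset[OF infinite_primes_greater] by blast
  show ?thesis
  proof
    show "inj_on (g \<circ> f) E"
      using f g(1) by (simp add: comp_inj_on inj_on_subset)
  qed (use g(2) in auto)
qed

text \<open>The index is the slope of the ray from the origin through the point, and
  \<open>a > 0\<close> keeps the point off the origin.\<close>

lemma fan_point_inj: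
  assumes "N > 0" "a > 0" "fan_point N a i = fan_point N b j"
  shows "i = j"
proof -
  have "real ((N + 1) * a) / real N = real ((N + 1) * b) / real N"
    "real ((N + 1) * a * i) / real N = real ((N + 1) * b * j) / real N"
    using assms(3) unfolding fan_point_def by (metis vector_2)+
  then have "(N + 1) * a = (N + 1) * b" and *: "(N + 1) * a * i = (N + 1) * b * j"
    using assms(1) by (simp_all only: divide_cancel_right of_nat_eq_iff of_nat_eq_0_iff) auto
  then have "a = b"
    by (metis add_is_0 mult_left_cancel one_neq_zero)
  then show ?thesis
    using * assms(2) by simp
qed

text \<open>Edges are unordered here so that the two opposite arcs of an edge share one
  prime.\<close>

lemma visibility_representation:
  fixes V :: "'a set" and E :: "'a set set"
  assumes "finite V" "finite E"
    and two: "\<And>e. e \<in> E \<Longrightarrow> \<exists>u v. e = {u, v}"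
  obtains p :: "'a \<Rightarrow> real^2" where "inj_on p V"
    "\<And>u v. \<lbrakk>u \<in> V; v \<in> V; u \<noteq> v\<rbrakk> \<Longrightarrow>
      (p u, p v) \<in> arcs (visibility_graph (p ` V \<union> integer_lattice)) \<longleftrightarrow> {u, v} \<in> E"
proof -
  obtain i :: "'a \<Rightarrow> nat" and n where i: "i ` V = {k. k < n}" "inj_on i V"
    using finite_imp_inj_to_nat_seg[OF assms(1)] by blast
  obtain q :: "'a set \<Rightarrow> nat"
    where q: "inj_on q E" "\<And>e. prime (q e)" "\<And>e. n < q e"
    using distinct_primes_greater[OF assms(2)] by blast
  define N where "N = prod q E"
  define c where "c v = prod q {e \<in> E. v \<notin> e}" for v
  define p where "p v = fan_point N (c v) (i v)" for v
  have "N > 0" and c_pos: "c v > 0" for v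
    using q(2) by (auto simp: N_def c_def prime_gt_0_nat intro!: prod_pos)
  have dvd_c_iff: "q e dvd c v \<longleftrightarrow> v \<notin> e" if "e \<in> E" for e v
  proof
    assume "q e dvd c v"
    then obtain e' where "e' \<in> E" "v \<notin> e'" "q e dvd q e'"
      using assms(2) q(2) by (auto simp: c_def prime_dvd_prod_iff)
    then show "v \<notin> e"
      using that q by (metis inj_onD primes_dvd_imp_eq)
  qed (use that assms(2) in \<open>auto simp: c_def intro: dvd_prodI\<close>)
  have inj: "inj_on p V"
    using i(2) fan_point_inj[OF \<open>N > 0\<close> c_pos] by (auto simp: p_def inj_on_def)
  moreover have "(p u, p v) \<in> arcs (visibility_graph (p ` V \<union> integer_lattice)) \<longleftrightarrow> {u, v} \<in> E"
    if uv: "u \<in> V" "v \<in> V" "u \<noteq> v" for u v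
  proof -
    have neq: "p u \<noteq> p v"
      using inj uv by (auto dest: inj_onD)
    have edge: "z = p u \<or> z = p v"
      if e: "{u, v} \<in> E" and z: "z \<in> p ` V \<union> integer_lattice" "z \<in> closed_segment (p u) (p v)" for z
    proof (rule ccontr)
      let ?r = "q {u, v}"
      assume nz: "\<not> (z = p u \<or> z = p v)"
      have "?r dvd N"
        using e assms(2) by (auto simp: N_def intro: dvd_prodI)
      have "\<exists>z1 z2. real N * z $ 1 = of_int z1 \<and> real N * z $ 2 = of_int z2 \<and>
          int ?r dvd z1 \<and> int ?r dvd z2"
        using z(1)
      proof
        assume "z \<in> p ` V"
        then obtain w where w: "z = p w" by blast
        then have "?r dvd c w"
          using nz e by (auto simp: dvd_c_iff)
        then show ?thesis
          using \<open>N > 0\<close>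
          by (intro exI[of _ "int ((N + 1) * c w)"] exI[of _ "int ((N + 1) * c w * i w)"])
            (simp add: w p_def fan_point_def)
      next
        assume "z \<in> integer_lattice"
        then obtain m1 m2 where "z $ 1 = of_int m1" "z $ 2 = of_int m2"
          unfolding integer_lattice_def by (auto elim!: Ints_cases)
            (metis Ints_cases)
        then show ?thesis
          using \<open>?r dvd N\<close> by (intro exI[of _ "int N * m1"] exI[of _ "int N * m2"]) simp
      qed
      then obtain z1 z2 where z': "real N * z $ 1 = of_int z1" "real N * z $ 2 = of_int z2"
          "int ?r dvd z1" "int ?r dvd z2"
        by blast
      have "i u < n" "i v < n" "i u \<noteq> i v"
        using i uv by (auto dest: inj_onD)
      \<comment> \<open>Distinct indices below \<open>n\<close> differ by a nonzero amount less than
        \<open>n\<close>, hence less than the prime.\<close>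
      then have "\<not> int ?r dvd int (i v) - int (i u)"
        using q(3)[of "{u, v}"] zdvd_not_zless[of "\<bar>int (i v) - int (i u)\<bar>" "int ?r"] by auto
      then have "z \<notin> closed_segment (p u) (p v)"
        unfolding p_def using e
        by (intro not_between_fan_points[OF q(2) \<open>?r dvd N\<close> \<open>N > 0\<close> _ _ _ z'])
          (auto simp: dvd_c_iff)
      then show False
        using z(2) by simp
    qed
    have nonedge: "\<exists>z\<in>integer_lattice. z \<in> open_segment (p u) (p v)" if e: "{u, v} \<notin> E"
      unfolding p_def
    proof (rule lattice_point_between_fan_points)
      have avoid: "v \<notin> e" if "e \<in> E" "u \<in> e" for e
        using two[OF that(1)] that e uv(3) by (auto simp: insert_commute)
      \<comment> \<open>The first factor is \<open>c u\<close> itself; the second divides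
        \<open>c v\<close> because every edge at \<open>u\<close> avoids \<open>v\<close>.\<close>
      let ?A = "prod q {e \<in> E. u \<notin> e}" and ?B = "prod q {e \<in> E. u \<in> e}"
      show "coprime ?A ?B"
        using q by (intro prod_coprime_left prod_coprime_right primes_coprime) (auto dest: inj_onD)
      have "{e \<in> E. u \<notin> e} \<union> {e \<in> E. u \<in> e} = E"
        by auto
      then show "?A * ?B = N"
        unfolding N_def using assms(2) by (subst prod.union_disjoint[symmetric]) auto
      show "?A dvd c u"
        by (simp add: c_def)
      show "?B dvd c v"
        unfolding c_def using assms(2) avoid by (intro prod_dvd_prod_subset) auto
    qed (use neq \<open>N > 0\<close> in \<open>auto simp: p_def\<close>)
    show ?thesis
      using edge nonedge neq uv by (auto simp: visibility_graph_def open_segment_def)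
  qed
  ultimately show ?thesis
    by (rule that)
qed

theorem theorem2:
  fixes G :: "('a, 'b) pre_digraph"
  assumes "Digraph.graph G"
  shows "\<exists>X :: (real^2) set. finite X \<and>
           digraph_iso (visibility_graph (X \<union> integer_lattice) \<restriction> X) G"
proof -
  interpret Digraph.graph G by fact
  let ?E = "(\<lambda>a. {tail G a, head G a}) ` arcs G"
  have arc_iff: "{u, v} \<in> ?E \<longleftrightarrow> (\<exists>a\<in>arcs G. tail G a = u \<and> head G a = v)" for u v
  proof
    assume "{u, v} \<in> ?E"
    then have "u \<rightarrow>\<^bsub>G\<^esub> v \<or> v \<rightarrow>\<^bsub>G\<^esub> u"
      by (auto simp: doubleton_eq_iff arcs_ends_conv)
    \<comment> \<open>The unordered pair forgets the direction of the arc; symmetry of the graph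
      restores it.\<close>
    then have "u \<rightarrow>\<^bsub>G\<^esub> v"
      using graph_symmetric by blast
    then show "\<exists>a\<in>arcs G. tail G a = u \<and> head G a = v"
      by (auto simp: arcs_ends_conv)
  qed auto
  obtain p :: "'a \<Rightarrow> real^2" where p: "inj_on p (verts G)"
    "\<And>u v. \<lbrakk>u \<in> verts G; v \<in> verts G; u \<noteq> v\<rbrakk> \<Longrightarrow>
      (p u, p v) \<in> arcs (visibility_graph (p ` verts G \<union> integer_lattice)) \<longleftrightarrow> {u, v} \<in> ?E"
    by (rule visibility_representation[of "verts G" ?E]) auto
  let ?X = "p ` verts G"
  let ?H = "visibility_graph (?X \<union> integer_lattice) \<restriction> ?X"
  \<comment> \<open>Arcs of a visibility graph are pairs of points, so each arc must map to the pair
    of its end images; this is injective as there are no parallel arcs.\<close>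
  define h where "h = \<lparr> iso_verts = p, iso_arcs = (\<lambda>a. (p (tail G a), p (head G a))),
    iso_head = snd, iso_tail = fst \<rparr>"
  have "inj_on (iso_arcs h) (arcs G)"
  proof (rule inj_onI)
    fix a b assume ab: "a \<in> arcs G" "b \<in> arcs G" "iso_arcs h a = iso_arcs h b"
    then have "arc_to_ends G a = arc_to_ends G b"
      using p(1) by (auto simp: h_def arc_to_ends_def dest: inj_onD)
    then show "a = b"
      using ab no_multi_arcs by blast
  qed
  then have "digraph_isomorphism h"
    using p(1) wf_digraph by (simp add: digraph_isomorphism_def h_def)
  moreover have "arcs ?H = iso_arcs h ` arcs G"
  proof (intro set_eqI iffI)
    fix x assume x: "x \<in> arcs ?H"
    then obtain u v where uv: "u \<in> verts G" "v \<in> verts G" "x = (p u, p v)"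
      by (cases x) (auto simp: visibility_graph_def)
    moreover have "u \<noteq> v"
      using x uv by (auto simp: visibility_graph_def)
    ultimately have "{u, v} \<in> ?E"
      using x p(2) by simp
    then show "x \<in> iso_arcs h ` arcs G"
      unfolding arc_iff using uv by (auto simp: h_def)
  next
    fix x assume "x \<in> iso_arcs h ` arcs G"
    then obtain a where a: "a \<in> arcs G" "x = (p (tail G a), p (head G a))"
      by (auto simp: h_def)
    then have "x \<in> arcs (visibility_graph (?X \<union> integer_lattice))"
      using p(2)[of "tail G a" "head G a"] no_loops[of a] by auto
    then show "x \<in> arcs ?H"
      using a by (simp add: visibility_graph_def)
  qed
  then have "?H = app_iso h G"
    by (intro pre_digraph.equality) (simp_all add: h_def visibility_graph_def)
  ultimately have "digraph_iso G ?H"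
    unfolding digraph_iso_def by blast
  \<comment> \<open>\<open>h\<close> maps \<open>G\<close> onto \<open>?H\<close>, opposite to the
    direction of the claim.\<close>
  then have "digraph_iso ?H G"
    by (rule digraph_iso_swap[OF wf_digraph])
  then show ?thesis
    by (intro exI[of _ ?X]) simp
qed

end
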